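(* None of the pure type systems $\lambda^\tau$, $\lambda2$, $\lambda\omega$, $\lambda\underline{\omega}$, $\lambda\mathrm{P2}$, $\lambda\mathrm{P}\underline{\omega}$, $\lambda\mathrm C$, $\lambda\mathrm{AUT\text{-}68}$, $\lambda\mathrm{AUT\text{-}QE}$, $\lambda\mathrm{PAL}$, $\lambda\mathrm U$ and $\lambda\mathrm{HOL}$ has an equivalent Hilbert-style pure type system.
   Context: Pure type systems (PTS): a PTS has variables, constants $\mathcal C$, sorts $\mathcal S\subseteq\mathcal C$, axioms $\mathcal A$ ($c:s$), rules $\mathcal R\subseteq\mathcal S^3$; pseudoterms $\mathcal T::=V\mid\mathcal C\mid\Pi V{:}\mathcal T.\mathcal T\mid\lambda V{:}\mathcal T.\mathcal T\mid\mathcal T\mathcal T$; derivable judgements $\Gamma\vdash M:A$ are generated by (axiom) $\vdash c:s$ for $(c:s)\in\mathcal A$; (start) $\Gamma\vdash A:s\Rightarrow\Gamma,x:A\vdash x:A$ ($x$ fresh); (weakening) $\Gamma\vdash M:B$, $\Gamma\vdash A:s\Rightarrow\Gamma,x:A\vdash M:B$ ($x$ fresh); (application) $\Gamma\vdash M:\Pi x{:}A.B$, $\Gamma\vdash N:A\Rightarrow\Gamma\vdash MN:B[x:=N]$; (abstraction) $\Gamma,x:A\vdash M:B$, $\Gamma\vdash(\Pi x{:}A.B):s\Rightarrow\Gamma\vdash(\lambda x{:}A.M):(\Pi x{:}A.B)$; (product) $\Gamma,x:A\vdash B:s_2$, $\Gamma\vdash A:s_1$, $(s_1,s_2,s_3)\in\mathcal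 R\Rightarrow\Gamma\vdash(\Pi x{:}A.B):s_3$; (conversion) $\Gamma\vdash M:A$, $\Gamma\vdash B:s$, $A=_\beta B\Rightarrow\Gamma\vdash M:B$. Hilbert-style PTS (HPTS): same pseudoterms, only empty contexts, axioms $\mathcal A$ plus a finite set $\mathcal B$ of axiom schemes (sort variables instantiable by sorts); rules: the axioms, (application), (conversion) with empty contexts, (type reduction) $\vdash M:A$, $A\to_\beta B\Rightarrow\vdash M:B$, (subject reduction) $\vdash M:A$, $M\to_\beta N\Rightarrow\vdash N:A$. An HPTS $(\mathcal S,\mathcal A,\mathcal B)$ is equivalent to the PTS $(\mathcal S,\mathcal A,\mathcal R)$ if both derive exactly the same empty-context judgements $\vdash M:A$. The systems (writing $(s_1,s_2)$ for $(s_1,s_2,s_2)$; except for $\lambda^\tau$, $\mathcal C=\mathcal S$ is the set of constants occurring in $\mathcal A$ and $\mathcal R$): $\lambda^\tau$: $\mathcal S=\{*\}$, $\mathcal C=\{*,0\}$, $\mathcal A=\{0:*\}$, $\mathcal R=\{( *,* )\}$. All the following have $\mathcal A=\{*:\square\}$ unless stated: $\lambda2$: $\mathcal R=\{( *,* ),(\square,* )\}$; $\lambda\underline\omega$: $\{( *,* ),(\square,\square)\}$; $\lambda\omega$: $\{( *,* ),(\square,* ),(\square,\square)\}$; $\lambda\mathrm{P2}$: $\{( *,* ),(\square,* ),( *,\square)\}$; $\lambda\mathrm P\underline\omega$: $\{( *,* ),( *,\square),(\square,\square)\}$; $\lambda\mathrm C$: $\{( *,* ),( *,\square),(\square,* ),(\square,\square)\}$;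 $\lambda\mathrm{AUT\text{-}68}$: $\{( *,* ),( *,\square,\triangle),(\square,*,\triangle),(\square,\square,\triangle),( *,\triangle),(\square,\triangle)\}$; $\lambda\mathrm{AUT\text{-}QE}$: $\{( *,* ),( *,\square),(\square,*,\triangle),(\square,\square,\triangle),( *,\triangle),(\square,\triangle)\}$; $\lambda\mathrm{PAL}$: $\{( *,*,\triangle),( *,\square,\triangle),(\square,*,\triangle),(\square,\square,\triangle),( *,\triangle),(\square,\triangle)\}$; $\lambda\mathrm U$: $\mathcal A=\{*:\square,\square:\triangle\}$, $\mathcal R=\{( *,* ),(\square,* ),(\square,\square),(\triangle,\square),(\triangle,* )\}$; $\lambda\mathrm{HOL}$: $\mathcal A=\{*:\square,\square:\triangle\}$, $\mathcal R=\{( *,* ),(\square,* ),(\square,\square)\}$. *)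

theory Defs
  imports Main
begin

text \<open>
  Pseudoterms over the constants \<^typ>\<open>'c\<close> are taken up to renaming of bound variables, using
  de Bruijn indices: \<open>Pi A B\<close> and \<open>Lam A M\<close> bind index 0 in their second argument only.
\<close>

datatype 'c pterm =
    Var nat
  | Const 'c
  | Pi "'c pterm" "'c pterm"
  | Lam "'c pterm" "'c pterm"
  | App "'c pterm" "'c pterm"

primrec lift :: "nat \<Rightarrow> 'c pterm \<Rightarrow> 'c pterm" where
  "lift k (Var i) = (if i < k then Var i else Var (Suc i))"
| "lift k (Const c) = Const c"
| "lift k (Pi A B) = Pi (lift k A) (lift (Suc k) B)"
| "lift k (Lam A M) = Lam (lift k A) (lift (Suc k) M)"
| "lift k (App M N) = App (lift k M) (lift k N)"

text \<open>
  \<open>subst M N k\<close> replaces index \<open>k\<close> in \<open>M\<close> by \<open>N\<close> and removes that index, so that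
  \<open>subst M N 0\<close> is \<open>M[x := N]\<close> for the outermost variable \<open>x\<close> of \<open>M\<close>.
\<close>

primrec subst :: "'c pterm \<Rightarrow> 'c pterm \<Rightarrow> nat \<Rightarrow> 'c pterm" where
  "subst (Var i) N k = (if i < k then Var i else if i = k then N else Var (i - 1))"
| "subst (Const c) N k = Const c"
| "subst (Pi A B) N k = Pi (subst A N k) (subst B (lift 0 N) (Suc k))"
| "subst (Lam A M) N k = Lam (subst A N k) (subst M (lift 0 N) (Suc k))"
| "subst (App M P) N k = App (subst M N k) (subst P N k)"

inductive beta :: "'c pterm \<Rightarrow> 'c pterm \<Rightarrow> bool" (infix "\<rightarrow>\<^sub>\<beta>" 50) where
  beta_redex: "App (Lam A M) N \<rightarrow>\<^sub>\<beta> subst M N 0"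
| beta_Pi1: "A \<rightarrow>\<^sub>\<beta> A' \<Longrightarrow> Pi A B \<rightarrow>\<^sub>\<beta> Pi A' B"
| beta_Pi2: "B \<rightarrow>\<^sub>\<beta> B' \<Longrightarrow> Pi A B \<rightarrow>\<^sub>\<beta> Pi A B'"
| beta_Lam1: "A \<rightarrow>\<^sub>\<beta> A' \<Longrightarrow> Lam A M \<rightarrow>\<^sub>\<beta> Lam A' M"
| beta_Lam2: "M \<rightarrow>\<^sub>\<beta> M' \<Longrightarrow> Lam A M \<rightarrow>\<^sub>\<beta> Lam A M'"
| beta_App1: "M \<rightarrow>\<^sub>\<beta> M' \<Longrightarrow> App M N \<rightarrow>\<^sub>\<beta> App M' N"
| beta_App2: "N \<rightarrow>\<^sub>\<beta> N' \<Longrightarrow> App M N \<rightarrow>\<^sub>\<beta> App M N'"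

abbreviation beta_eq :: "'c pterm \<Rightarrow> 'c pterm \<Rightarrow> bool" (infix "=\<^sub>\<beta>" 50) where
  "A =\<^sub>\<beta> B \<equiv> equivclp beta A B"

text \<open>
  The set of constants of a system is the whole type \<^typ>\<open>'c\<close>.
\<close>

record 'c pts =
  sorts :: "'c set"
  axioms :: "('c \<times> 'c) set"
  rules :: "('c \<times> 'c \<times> 'c) set"

definition wf_pts :: "'c pts \<Rightarrow> bool" where
  "wf_pts P \<longleftrightarrow> axioms P \<subseteq> UNIV \<times> sorts P \<and> rules P \<subseteq> sorts P \<times> sorts P \<times> sorts P"

text \<open>
  The head of a context is its most recent declaration; lifting makes the freshness conditions
  of (start) and (weakening) automatic.
\<close>

inductive typing :: "'c pts \<Rightarrow> 'c pterm list \<Rightarrow> 'c pterm \<Rightarrow> 'c pterm \<Rightarrow> bool"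
  for P :: "'c pts" where
  ax: "(c, s) \<in> axioms P \<Longrightarrow> typing P [] (Const c) (Const s)"
| start: "typing P \<Gamma> A (Const s) \<Longrightarrow> s \<in> sorts P \<Longrightarrow> typing P (A # \<Gamma>) (Var 0) (lift 0 A)"
| weakening: "typing P \<Gamma> M B \<Longrightarrow> typing P \<Gamma> A (Const s) \<Longrightarrow> s \<in> sorts P \<Longrightarrow>
    typing P (A # \<Gamma>) (lift 0 M) (lift 0 B)"
| application: "typing P \<Gamma> M (Pi A B) \<Longrightarrow> typing P \<Gamma> N A \<Longrightarrow>
    typing P \<Gamma> (App M N) (subst B N 0)"
| abstraction: "typing P (A # \<Gamma>) M B \<Longrightarrow> typing P \<Gamma> (Pi A B) (Const s) \<Longrightarrow> s \<in> sorts P \<Longrightarrow>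
    typing P \<Gamma> (Lam A M) (Pi A B)"
| product: "typing P (A # \<Gamma>) B (Const s2) \<Longrightarrow> typing P \<Gamma> A (Const s1) \<Longrightarrow>
    (s1, s2, s3) \<in> rules P \<Longrightarrow> typing P \<Gamma> (Pi A B) (Const s3)"
| conversion: "typing P \<Gamma> M A \<Longrightarrow> typing P \<Gamma> B (Const s) \<Longrightarrow> s \<in> sorts P \<Longrightarrow> A =\<^sub>\<beta> B \<Longrightarrow>
    typing P \<Gamma> M B"

text \<open>
  An axiom scheme is a statement \<open>M : A\<close> whose terms may contain sort variables, here
  additional constants \<open>SortVar i\<close>; its instances replace the sort variables uniformly by sorts.
\<close>

datatype 'c sconst = Fixed 'c | SortVar nat

primrec inst_const :: "(nat \<Rightarrow> 'c) \<Rightarrow> 'c sconst \<Rightarrow> 'c" where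
  "inst_const \<sigma> (Fixed c) = c"
| "inst_const \<sigma> (SortVar i) = \<sigma> i"

abbreviation inst :: "(nat \<Rightarrow> 'c) \<Rightarrow> 'c sconst pterm \<Rightarrow> 'c pterm" where
  "inst \<sigma> \<equiv> map_pterm (inst_const \<sigma>)"

record 'c hpts =
  hsorts :: "'c set"
  haxioms :: "('c \<times> 'c) set"
  schemes :: "('c sconst pterm \<times> 'c sconst pterm) set"

definition wf_hpts :: "'c hpts \<Rightarrow> bool" where
  "wf_hpts H \<longleftrightarrow> haxioms H \<subseteq> UNIV \<times> hsorts H \<and> finite (schemes H)"

inductive htyping :: "'c hpts \<Rightarrow> 'c pterm \<Rightarrow> 'c pterm \<Rightarrow> bool"
  for H :: "'c hpts" where
  h_ax: "(c, s) \<in> haxioms H \<Longrightarrow> htyping H (Const c) (Const s)"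
| h_scheme: "(M, A) \<in> schemes H \<Longrightarrow> range \<sigma> \<subseteq> hsorts H \<Longrightarrow> htyping H (inst \<sigma> M) (inst \<sigma> A)"
| h_application: "htyping H M (Pi A B) \<Longrightarrow> htyping H N A \<Longrightarrow> htyping H (App M N) (subst B N 0)"
| h_conversion: "htyping H M A \<Longrightarrow> htyping H B (Const s) \<Longrightarrow> s \<in> hsorts H \<Longrightarrow> A =\<^sub>\<beta> B \<Longrightarrow>
    htyping H M B"
| h_type_reduction: "htyping H M A \<Longrightarrow> A \<rightarrow>\<^sub>\<beta> B \<Longrightarrow> htyping H M B"
| h_subject_reduction: "htyping H M A \<Longrightarrow> M \<rightarrow>\<^sub>\<beta> N \<Longrightarrow> htyping H N A"

definition equivalent :: "'c hpts \<Rightarrow> 'c pts \<Rightarrow> bool" where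
  "equivalent H P \<longleftrightarrow> hsorts H = sorts P \<and> haxioms H = axioms P \<and>
     (\<forall>M A. htyping H M A \<longleftrightarrow> typing P [] M A)"

definition has_equivalent_hpts :: "'c pts \<Rightarrow> bool" where
  "has_equivalent_hpts P \<longleftrightarrow> (\<exists>H. wf_hpts H \<and> equivalent H P)"

datatype tau_const = StarT | ZeroT

definition lambda_tau :: "tau_const pts" where
  "lambda_tau = \<lparr>sorts = {StarT}, axioms = {(ZeroT, StarT)}, rules = {(StarT, StarT, StarT)}\<rparr>"

datatype cube_const = StarC | BoxC

definition cube :: "(cube_const \<times> cube_const \<times> cube_const) set \<Rightarrow> cube_const pts" where
  "cube R = \<lparr>sorts = {StarC, BoxC}, axioms = {(StarC, BoxC)}, rules = R\<rparr>"

definition lambda_2 :: "cube_const pts" where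
  "lambda_2 = cube {(StarC, StarC, StarC), (BoxC, StarC, StarC)}"

definition lambda_weak_omega :: "cube_const pts" where
  "lambda_weak_omega = cube {(StarC, StarC, StarC), (BoxC, BoxC, BoxC)}"

definition lambda_omega :: "cube_const pts" where
  "lambda_omega = cube {(StarC, StarC, StarC), (BoxC, StarC, StarC), (BoxC, BoxC, BoxC)}"

definition lambda_P2 :: "cube_const pts" where
  "lambda_P2 = cube {(StarC, StarC, StarC), (BoxC, StarC, StarC), (StarC, BoxC, BoxC)}"

definition lambda_P_weak_omega :: "cube_const pts" where
  "lambda_P_weak_omega = cube {(StarC, StarC, StarC), (StarC, BoxC, BoxC), (BoxC, BoxC, BoxC)}"

definition lambda_C :: "cube_const pts" where
  "lambda_C = cube {(StarC, StarC, StarC), (StarC, BoxC, BoxC), (BoxC, StarC, StarC),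
     (BoxC, BoxC, BoxC)}"

datatype tri_const = Star | Box | Triangle

definition lambda_AUT68 :: "tri_const pts" where
  "lambda_AUT68 = \<lparr>sorts = {Star, Box, Triangle}, axioms = {(Star, Box)},
     rules = {(Star, Star, Star), (Star, Box, Triangle), (Box, Star, Triangle),
       (Box, Box, Triangle), (Star, Triangle, Triangle), (Box, Triangle, Triangle)}\<rparr>"

definition lambda_AUTQE :: "tri_const pts" where
  "lambda_AUTQE = \<lparr>sorts = {Star, Box, Triangle}, axioms = {(Star, Box)},
     rules = {(Star, Star, Star), (Star, Box, Box), (Box, Star, Triangle),
       (Box, Box, Triangle), (Star, Triangle, Triangle), (Box, Triangle, Triangle)}\<rparr>"

definition lambda_PAL :: "tri_const pts" where
  "lambda_PAL = \<lparr>sorts = {Star, Box, Triangle}, axioms = {(Star, Box)},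
     rules = {(Star, Star, Triangle), (Star, Box, Triangle), (Box, Star, Triangle),
       (Box, Box, Triangle), (Star, Triangle, Triangle), (Box, Triangle, Triangle)}\<rparr>"

definition lambda_U :: "tri_const pts" where
  "lambda_U = \<lparr>sorts = {Star, Box, Triangle}, axioms = {(Star, Box), (Box, Triangle)},
     rules = {(Star, Star, Star), (Box, Star, Star), (Box, Box, Box),
       (Triangle, Box, Box), (Triangle, Star, Star)}\<rparr>"

definition lambda_HOL :: "tri_const pts" where
  "lambda_HOL = \<lparr>sorts = {Star, Box, Triangle}, axioms = {(Star, Box), (Box, Triangle)},
     rules = {(Star, Star, Star), (Box, Star, Star), (Box, Box, Box)}\<rparr>"

lemma wf_pts_systems:
  "wf_pts lambda_tau" "wf_pts lambda_2" "wf_pts lambda_omega" "wf_pts lambda_weak_omega"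
  "wf_pts lambda_P2" "wf_pts lambda_P_weak_omega" "wf_pts lambda_C" "wf_pts lambda_AUT68"
  "wf_pts lambda_AUTQE" "wf_pts lambda_PAL" "wf_pts lambda_U" "wf_pts lambda_HOL"
  by (simp_all add: wf_pts_def cube_def lambda_tau_def lambda_2_def lambda_omega_def
      lambda_weak_omega_def lambda_P2_def lambda_P_weak_omega_def lambda_C_def lambda_AUT68_def
      lambda_AUTQE_def lambda_PAL_def lambda_U_def lambda_HOL_def)

end

theory Submission
  imports Defs "HOL-Library.Confluence"
begin

text \<open>
  Let \<open>T\<close> be a set of sorts such that no rule \<open>(s\<^sub>1, t', s\<^sub>3)\<close> has a second component \<open>t'\<close> that
  types a sort \<open>t\<close> in \<open>T\<close>. Then an application \<open>F N\<close> never inhabits a sort \<open>t\<close> in \<open>T\<close>: if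
  \<open>F : \<Pi>x:A. B\<close> and \<open>B : t'\<close>, then \<open>B[N]\<close> reduces to \<open>t\<close>, and subject reduction gives \<open>t : t'\<close>.
  Hence an equivalent Hilbert-style system derives \<open>M : t\<close> only for reducts \<open>M\<close> of the subjects of
  its axioms, and up to the choice of sorts these are finitely many.

  On the other hand \<open>T\<close> is inhabited by towers \<open>\<Pi>x\<^sub>1:K. \<dots> \<Pi>x\<^sub>n:K. E\<close> of every height \<open>n\<close>. Products
  of a tower cannot be created by reduction: the inner towers are also typed by sorts in \<open>T\<close>, so by
  subject reduction every term along the spine of a typable \<open>M\<close> reducing to the tower inhabits a
  sort in \<open>T\<close> and is itself a product. So \<open>n\<close> is at most the size of \<open>M\<close>, which is bounded
  over the axioms.
\<close>

section \<open>Simultaneous substitution\<close>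

definition lift_subst :: "(nat \<Rightarrow> 'c pterm) \<Rightarrow> nat \<Rightarrow> 'c pterm" where
  "lift_subst \<sigma> = case_nat (Var 0) (lift 0 \<circ> \<sigma>)"

definition lift_renaming :: "(nat \<Rightarrow> nat) \<Rightarrow> nat \<Rightarrow> nat" where
  "lift_renaming \<rho> = case_nat 0 (Suc \<circ> \<rho>)"

primrec psubst :: "(nat \<Rightarrow> 'c pterm) \<Rightarrow> 'c pterm \<Rightarrow> 'c pterm" where
  "psubst \<sigma> (Var i) = \<sigma> i"
| "psubst \<sigma> (Const c) = Const c"
| "psubst \<sigma> (Pi A B) = Pi (psubst \<sigma> A) (psubst (lift_subst \<sigma>) B)"
| "psubst \<sigma> (Lam A M) = Lam (psubst \<sigma> A) (psubst (lift_subst \<sigma>) M)"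
| "psubst \<sigma> (App M N) = App (psubst \<sigma> M) (psubst \<sigma> N)"

lemma lift_subst_simps [simp]:
  "lift_subst \<sigma> 0 = Var 0" "lift_subst \<sigma> (Suc i) = lift 0 (\<sigma> i)"
  by (simp_all add: lift_subst_def)

lemma lift_subst_comp_Suc [simp]: "lift_subst \<sigma> \<circ> Suc = lift 0 \<circ> \<sigma>"
  by (simp add: fun_eq_iff)

lemma lift_renaming_simps [simp]:
  "lift_renaming \<rho> 0 = 0" "lift_renaming \<rho> (Suc i) = Suc (\<rho> i)"
  by (simp_all add: lift_renaming_def)

lemma lift_renaming_comp_Suc [simp]: "lift_renaming \<rho> \<circ> Suc = Suc \<circ> \<rho>"
  by (simp add: fun_eq_iff)

lemma lift_subst_Var: "lift_subst Var = Var"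
  by (simp add: fun_eq_iff lift_subst_def split: nat.split)

lemma psubst_Var [simp]: "psubst Var M = M"
  by (induction M) (simp_all add: lift_subst_Var)

lemma lift_eq_psubst: "lift k M = psubst (\<lambda>i. if i < k then Var i else Var (Suc i)) M"
proof -
  have lift_subst_eq: "lift_subst (\<lambda>i. if i < k then Var i else Var (Suc i)) =
      (\<lambda>i. if i < Suc k then Var i else Var (Suc i) :: 'a pterm)" for k
    by (auto simp: fun_eq_iff lift_subst_def split: nat.split)
  show ?thesis by (induction M arbitrary: k) (simp_all add: lift_subst_eq)
qed

lemma lift_0_eq_psubst: "lift 0 M = psubst (Var \<circ> Suc) M"
  by (simp add: lift_eq_psubst comp_def)

lemma lift_1_eq_psubst: "lift 1 M = psubst (lift_subst (Var \<circ> Suc)) M"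
proof -
  have "(\<lambda>i. if i < 1 then Var i else Var (Suc i)) = lift_subst (Var \<circ> Suc)"
    by (simp add: fun_eq_iff lift_subst_def split: nat.split)
  then show ?thesis unfolding lift_eq_psubst by (rule arg_cong)
qed

lemma subst_eq_psubst:
  "subst M N k = psubst (\<lambda>i. if i < k then Var i else if i = k then N else Var (i - 1)) M"
proof -
  have lift_subst_eq: "lift_subst (\<lambda>i. if i < k then Var i else if i = k then N else Var (i - 1)) =
      (\<lambda>i. if i < Suc k then Var i else if i = Suc k then lift 0 N else Var (i - 1))"
    for N :: "'a pterm" and k
    by (auto simp: fun_eq_iff lift_subst_def split: nat.split)
  show ?thesis
    by (induction M arbitrary: N k) (simp_all only: subst.simps psubst.simps lift_subst_eq)
qed

lemma subst_0_eq_psubst: "subst M N 0 = psubst (case_nat N Var) M"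
proof -
  have "(\<lambda>i. if i < 0 then Var i else if i = 0 then N else Var (i - 1)) = case_nat N Var"
    by (auto split: nat.split)
  then show ?thesis by (simp only: subst_eq_psubst)
qed

lemma lift_subst_comp_Var: "lift_subst (Var \<circ> \<rho>) = Var \<circ> lift_renaming \<rho>"
  by (simp add: fun_eq_iff lift_subst_def lift_renaming_def split: nat.split)

lemma lift_subst_comp_lift_renaming: "lift_subst \<sigma> \<circ> lift_renaming \<rho> = lift_subst (\<sigma> \<circ> \<rho>)"
  by (simp add: fun_eq_iff lift_subst_def lift_renaming_def split: nat.split)

lemma psubst_renaming: "psubst \<sigma> (psubst (Var \<circ> \<rho>) M) = psubst (\<sigma> \<circ> \<rho>) M"
  by (induction M arbitrary: \<sigma> \<rho>)
    (simp_all add: lift_subst_comp_Var lift_subst_comp_lift_renaming)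

lemma psubst_lift: "psubst \<sigma> (lift 0 M) = psubst (\<sigma> \<circ> Suc) M"
  by (simp only: lift_0_eq_psubst psubst_renaming)

lemma renaming_comp_lift_subst:
  "psubst (Var \<circ> lift_renaming \<rho>) \<circ> lift_subst \<sigma> = lift_subst (psubst (Var \<circ> \<rho>) \<circ> \<sigma>)"
proof
  show "(psubst (Var \<circ> lift_renaming \<rho>) \<circ> lift_subst \<sigma>) i =
      lift_subst (psubst (Var \<circ> \<rho>) \<circ> \<sigma>) i" for i
    by (cases i)
      (simp_all add: lift_0_eq_psubst psubst_renaming comp_assoc)
qed

lemma renaming_psubst:
  "psubst (Var \<circ> \<rho>) (psubst \<sigma> M) = psubst (psubst (Var \<circ> \<rho>) \<circ> \<sigma>) M"
  by (induction M arbitrary: \<sigma> \<rho>)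
    (simp_all add: lift_subst_comp_Var renaming_comp_lift_subst)

lemma psubst_lift_comp: "psubst (lift 0 \<circ> \<sigma>) M = lift 0 (psubst \<sigma> M)"
  by (simp add: lift_0_eq_psubst[abs_def] renaming_psubst)

lemma psubst_comp_lift_subst: "psubst (lift_subst \<tau>) \<circ> lift_subst \<sigma> = lift_subst (psubst \<tau> \<circ> \<sigma>)"
proof
  show "(psubst (lift_subst \<tau>) \<circ> lift_subst \<sigma>) i = lift_subst (psubst \<tau> \<circ> \<sigma>) i" for i
    by (cases i) (simp_all add: psubst_lift psubst_lift_comp)
qed

lemma psubst_psubst: "psubst \<tau> (psubst \<sigma> M) = psubst (psubst \<tau> \<circ> \<sigma>) M"
  by (induction M arbitrary: \<sigma> \<tau>) (simp_all add: psubst_comp_lift_subst)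

lemma psubst_subst: "psubst \<sigma> (subst B N 0) = subst (psubst (lift_subst \<sigma>) B) (psubst \<sigma> N) 0"
proof -
  have "psubst \<sigma> \<circ> case_nat N Var = psubst (case_nat (psubst \<sigma> N) Var) \<circ> lift_subst \<sigma>"
    by (simp add: fun_eq_iff lift_subst_def psubst_lift comp_def split: nat.split)
  then show ?thesis by (simp add: subst_0_eq_psubst psubst_psubst)
qed

lemma lift_0_subst: "lift 0 (subst B N 0) = subst (lift 1 B) (lift 0 N) 0"
  by (simp only: lift_0_eq_psubst lift_1_eq_psubst psubst_subst)

section \<open>Confluence of reduction\<close>

lemma rtranclp_map:
  assumes "r\<^sup>*\<^sup>* x y" and "\<And>x y. r x y \<Longrightarrow> s (f x) (f y)"
  shows "s\<^sup>*\<^sup>* (f x) (f y)"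
  using assms(1) by induction (auto intro: assms(2) rtranclp.rtrancl_into_rtrancl)

lemma rtranclp_map2:
  assumes "r\<^sup>*\<^sup>* x x'" "s\<^sup>*\<^sup>* y y'"
    and "\<And>x x' y. r x x' \<Longrightarrow> t (f x y) (f x' y)" and "\<And>x y y'. s y y' \<Longrightarrow> t (f x y) (f x y')"
  shows "t\<^sup>*\<^sup>* (f x y) (f x' y')"
proof -
  have "t\<^sup>*\<^sup>* (f x y) (f x' y)" using assms(1,3) by (rule rtranclp_map)
  also have "t\<^sup>*\<^sup>* (f x' y) (f x' y')" using assms(2,4) by (rule rtranclp_map)
  finally show ?thesis .
qed

lemma equivclp_map:
  assumes "equivclp r x y" and "\<And>x y. r x y \<Longrightarrow> equivclp s (f x) (f y)"
  shows "equivclp s (f x) (f y)"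
  using assms(1) by induction (auto intro: equivclp_trans equivclp_sym dest: assms(2))

abbreviation betas :: "'c pterm \<Rightarrow> 'c pterm \<Rightarrow> bool" (infix "\<rightarrow>\<^sub>\<beta>\<^sup>*" 50) where
  "M \<rightarrow>\<^sub>\<beta>\<^sup>* N \<equiv> beta\<^sup>*\<^sup>* M N"

lemma betas_Pi: "A \<rightarrow>\<^sub>\<beta>\<^sup>* A' \<Longrightarrow> B \<rightarrow>\<^sub>\<beta>\<^sup>* B' \<Longrightarrow> Pi A B \<rightarrow>\<^sub>\<beta>\<^sup>* Pi A' B'"
  by (erule (1) rtranclp_map2[where f = Pi]) (auto intro: beta_Pi1 beta_Pi2)

lemma betas_Lam: "A \<rightarrow>\<^sub>\<beta>\<^sup>* A' \<Longrightarrow> M \<rightarrow>\<^sub>\<beta>\<^sup>* M' \<Longrightarrow> Lam A M \<rightarrow>\<^sub>\<beta>\<^sup>* Lam A' M'"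
  by (erule (1) rtranclp_map2[where f = Lam]) (auto intro: beta_Lam1 beta_Lam2)

lemma betas_App: "M \<rightarrow>\<^sub>\<beta>\<^sup>* M' \<Longrightarrow> N \<rightarrow>\<^sub>\<beta>\<^sup>* N' \<Longrightarrow> App M N \<rightarrow>\<^sub>\<beta>\<^sup>* App M' N'"
  by (erule (1) rtranclp_map2[where f = App]) (auto intro: beta_App1 beta_App2)

inductive par_beta :: "'c pterm \<Rightarrow> 'c pterm \<Rightarrow> bool" (infix "\<Rrightarrow>" 50) where
  par_Var: "Var i \<Rrightarrow> Var i"
| par_Const: "Const c \<Rrightarrow> Const c"
| par_Pi: "A \<Rrightarrow> A' \<Longrightarrow> B \<Rrightarrow> B' \<Longrightarrow> Pi A B \<Rrightarrow> Pi A' B'"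
| par_Lam: "A \<Rrightarrow> A' \<Longrightarrow> M \<Rrightarrow> M' \<Longrightarrow> Lam A M \<Rrightarrow> Lam A' M'"
| par_App: "M \<Rrightarrow> M' \<Longrightarrow> N \<Rrightarrow> N' \<Longrightarrow> App M N \<Rrightarrow> App M' N'"
| par_redex: "M \<Rrightarrow> M' \<Longrightarrow> N \<Rrightarrow> N' \<Longrightarrow> App (Lam A M) N \<Rrightarrow> subst M' N' 0"

inductive_cases par_LamE: "Lam A M \<Rrightarrow> N"

lemma par_refl [simp]: "M \<Rrightarrow> M"
  by (induction M) (auto intro: par_beta.intros)

lemma beta_imp_par: "M \<rightarrow>\<^sub>\<beta> N \<Longrightarrow> M \<Rrightarrow> N"
  by (induction rule: beta.induct) (auto intro: par_beta.intros)

lemma par_imp_betas: "M \<Rrightarrow> N \<Longrightarrow> M \<rightarrow>\<^sub>\<beta>\<^sup>* N"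
proof (induction rule: par_beta.induct)
  case (par_redex M M' N N' A)
  then have "App (Lam A M) N \<rightarrow>\<^sub>\<beta>\<^sup>* App (Lam A M') N'"
    by (intro betas_App betas_Lam) auto
  also have "App (Lam A M') N' \<rightarrow>\<^sub>\<beta> subst M' N' 0" by (rule beta_redex)
  finally show ?case .
qed (auto intro: betas_Pi betas_Lam betas_App)

lemma pars_eq_betas: "par_beta\<^sup>*\<^sup>* = beta\<^sup>*\<^sup>*"
  by (rule rtranclp_subset) (auto simp: beta_imp_par par_imp_betas)

lemma par_psubst_left: "M \<Rrightarrow> N \<Longrightarrow> psubst \<sigma> M \<Rrightarrow> psubst \<sigma> N"
  by (induction arbitrary: \<sigma> rule: par_beta.induct)
    (auto intro: par_beta.intros simp: psubst_subst)

lemma par_lift_subst: "(\<And>i. \<sigma> i \<Rrightarrow> \<tau> i) \<Longrightarrow> lift_subst \<sigma> i \<Rrightarrow> lift_subst \<tau> i"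
  by (cases i) (auto simp: lift_0_eq_psubst par_psubst_left)

lemma par_psubst: "M \<Rrightarrow> N \<Longrightarrow> (\<And>i. \<sigma> i \<Rrightarrow> \<tau> i) \<Longrightarrow> psubst \<sigma> M \<Rrightarrow> psubst \<tau> N"
  by (induction arbitrary: \<sigma> \<tau> rule: par_beta.induct)
    (auto intro: par_beta.intros simp: psubst_subst par_lift_subst)

lemma par_subst: "M \<Rrightarrow> M' \<Longrightarrow> N \<Rrightarrow> N' \<Longrightarrow> subst M N 0 \<Rrightarrow> subst M' N' 0"
  by (auto simp: subst_0_eq_psubst intro!: par_psubst split: nat.split)

fun complete_dev :: "'c pterm \<Rightarrow> 'c pterm" where
  "complete_dev (Var i) = Var i"
| "complete_dev (Const c) = Const c"
| "complete_dev (Pi A B) = Pi (complete_dev A) (complete_dev B)"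
| "complete_dev (Lam A M) = Lam (complete_dev A) (complete_dev M)"
| "complete_dev (App (Lam A M) N) = subst (complete_dev M) (complete_dev N) 0"
| "complete_dev (App M N) = App (complete_dev M) (complete_dev N)"

lemma par_complete_dev: "M \<Rrightarrow> N \<Longrightarrow> N \<Rrightarrow> complete_dev M"
proof (induction rule: par_beta.induct)
  case (par_App M M' N N')
  show ?case
  proof (cases "\<exists>A K. M = Lam A K")
    case True
    then obtain A K where M: "M = Lam A K" by blast
    with \<open>M \<Rrightarrow> M'\<close> obtain A' K' where M': "M' = Lam A' K'" by (auto elim: par_LamE)
    have "K' \<Rrightarrow> complete_dev K" using par_App.IH(1) by (auto simp: M M' elim: par_LamE)
    with par_App.IH(2) show ?thesis by (simp add: M M' par_redex)
  next
    case False
    then have "complete_dev (App M N) = App (complete_dev M) (complete_dev N)"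
      by (cases M) auto
    with par_App.IH show ?thesis by (simp add: par_beta.par_App)
  qed
qed (auto intro: par_beta.intros par_subst)

lemma confluentp_beta: "confluentp beta"
proof -
  have "strong_confluentp par_beta"
    by (rule strong_confluentpI) (use par_complete_dev in blast)
  then have "confluentp par_beta" by (rule strong_confluentp_imp_confluentp)
  then show ?thesis
    by (simp only: confluentp_def pars_eq_betas rtranclp_conversep)
qed

lemma Church_Rosser:
  assumes "A =\<^sub>\<beta> B" obtains C where "A \<rightarrow>\<^sub>\<beta>\<^sup>* C" "B \<rightarrow>\<^sub>\<beta>\<^sup>* C"
proof -
  have "equivclp beta = beta\<^sup>*\<^sup>* OO beta\<inverse>\<inverse>\<^sup>*\<^sup>*"
    using confluentp_beta by (intro semiconfluentp_equivclp confluentp_imp_semiconfluentp)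
  from assms[unfolded this] have "(beta\<^sup>*\<^sup>* OO beta\<inverse>\<inverse>\<^sup>*\<^sup>*) A B" .
  with that show thesis by (auto simp: rtranclp_conversep)
qed

inductive_cases beta_ConstE: "Const c \<rightarrow>\<^sub>\<beta> M"
inductive_cases beta_VarE: "Var i \<rightarrow>\<^sub>\<beta> M"
inductive_cases beta_PiE: "Pi A B \<rightarrow>\<^sub>\<beta> M"

lemma betas_ConstD: "Const c \<rightarrow>\<^sub>\<beta>\<^sup>* M \<Longrightarrow> M = Const c"
  by (induction rule: rtranclp_induct) (auto elim: beta_ConstE)

lemma betas_VarD: "Var i \<rightarrow>\<^sub>\<beta>\<^sup>* M \<Longrightarrow> M = Var i"
  by (induction rule: rtranclp_induct) (auto elim: beta_VarE)

lemma betas_PiE: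
  assumes "Pi A B \<rightarrow>\<^sub>\<beta>\<^sup>* M"
  obtains A' B' where "M = Pi A' B'" "A \<rightarrow>\<^sub>\<beta>\<^sup>* A'" "B \<rightarrow>\<^sub>\<beta>\<^sup>* B'"
proof -
  have "\<exists>A' B'. M = Pi A' B' \<and> A \<rightarrow>\<^sub>\<beta>\<^sup>* A' \<and> B \<rightarrow>\<^sub>\<beta>\<^sup>* B'"
    using assms by (induction rule: rtranclp_induct)
      (auto elim!: beta_PiE intro: rtranclp.rtrancl_into_rtrancl)
  with that show thesis by blast
qed

lemma beta_eq_ConstD: "M =\<^sub>\<beta> Const c \<Longrightarrow> M \<rightarrow>\<^sub>\<beta>\<^sup>* Const c"
  by (auto elim!: Church_Rosser dest: betas_ConstD)

lemma Const_beta_eq_Const [simp]: "Const c =\<^sub>\<beta> Const d \<longleftrightarrow> c = d"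
  by (auto dest!: beta_eq_ConstD betas_ConstD)

lemma Pi_beta_eq_Const [simp]: "\<not> Pi A B =\<^sub>\<beta> Const c"
  by (auto dest!: beta_eq_ConstD elim: betas_PiE)

lemma Pi_beta_eq_PiD:
  assumes "Pi A B =\<^sub>\<beta> Pi A' B'" shows "A =\<^sub>\<beta> A'" and "B =\<^sub>\<beta> B'"
proof -
  obtain C D where "A \<rightarrow>\<^sub>\<beta>\<^sup>* C" "A' \<rightarrow>\<^sub>\<beta>\<^sup>* C" "B \<rightarrow>\<^sub>\<beta>\<^sup>* D" "B' \<rightarrow>\<^sub>\<beta>\<^sup>* D"
    using assms by (metis Church_Rosser betas_PiE pterm.inject(3))
  then show "A =\<^sub>\<beta> A'" "B =\<^sub>\<beta> B'"
    by (meson converse_rtranclp_into_equivclp equivclp_trans rtranclp_into_equivclp)+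
qed

lemma beta_eq_psubst: "M =\<^sub>\<beta> N \<Longrightarrow> psubst \<sigma> M =\<^sub>\<beta> psubst \<sigma> N"
  by (erule equivclp_map)
    (intro rtranclp_into_equivclp par_imp_betas par_psubst_left beta_imp_par)

lemma beta_eq_lift: "M =\<^sub>\<beta> N \<Longrightarrow> lift 0 M =\<^sub>\<beta> lift 0 N"
  by (simp add: lift_0_eq_psubst beta_eq_psubst)

lemma beta_eq_Pi1: "A =\<^sub>\<beta> A' \<Longrightarrow> Pi A B =\<^sub>\<beta> Pi A' B"
  by (erule equivclp_map) (auto intro: beta_Pi1)

lemma beta_eq_subst_left: "B =\<^sub>\<beta> B' \<Longrightarrow> subst B N 0 =\<^sub>\<beta> subst B' N 0"
  by (simp add: subst_0_eq_psubst beta_eq_psubst)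

lemma beta_eq_subst_right: "N =\<^sub>\<beta> N' \<Longrightarrow> subst B N 0 =\<^sub>\<beta> subst B N' 0"
  by (erule equivclp_map)
    (intro rtranclp_into_equivclp par_imp_betas par_subst par_refl beta_imp_par)

section \<open>Metatheory of pure type systems\<close>

locale pure_type_system =
  fixes P :: "'c pts"
  assumes wf: "wf_pts P"
begin

abbreviation typing_in :: "'c pterm list \<Rightarrow> 'c pterm \<Rightarrow> 'c pterm \<Rightarrow> bool"
  ("_ \<turnstile> _ : _" [51, 51, 51] 50) where
  "\<Gamma> \<turnstile> M : A \<equiv> typing P \<Gamma> M A"

lemma axiom_in_sorts: "(c, s) \<in> axioms P \<Longrightarrow> s \<in> sorts P"
  using wf by (auto simp: wf_pts_def)

lemma rule_in_sorts:
  assumes "(s1, s2, s3) \<in> rules P"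
  shows "s1 \<in> sorts P" "s2 \<in> sorts P" "s3 \<in> sorts P"
  using assms wf by (auto simp: wf_pts_def)

definition is_type :: "'c pterm list \<Rightarrow> 'c pterm \<Rightarrow> bool" where
  "is_type \<Gamma> A \<longleftrightarrow> (\<exists>s \<in> sorts P. \<Gamma> \<turnstile> A : Const s)"

lemma is_typeI: "\<Gamma> \<turnstile> A : Const s \<Longrightarrow> s \<in> sorts P \<Longrightarrow> is_type \<Gamma> A"
  by (auto simp: is_type_def)

lemma typing_start: "is_type \<Gamma> A \<Longrightarrow> A # \<Gamma> \<turnstile> Var 0 : lift 0 A"
  by (auto simp: is_type_def intro: start)

lemma typing_weaken: "\<Gamma> \<turnstile> M : B \<Longrightarrow> is_type \<Gamma> A \<Longrightarrow> A # \<Gamma> \<turnstile> lift 0 M : lift 0 B"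
  by (auto simp: is_type_def intro: weakening)

lemma typing_convert: "\<Gamma> \<turnstile> M : A \<Longrightarrow> is_type \<Gamma> B \<Longrightarrow> A =\<^sub>\<beta> B \<Longrightarrow> \<Gamma> \<turnstile> M : B"
  by (auto simp: is_type_def intro: conversion)

lemma is_type_weaken: "is_type \<Gamma> A \<Longrightarrow> is_type \<Gamma> D \<Longrightarrow> is_type (D # \<Gamma>) (lift 0 A)"
  by (metis is_type_def typing_weaken lift.simps(2))

primrec valid :: "'c pterm list \<Rightarrow> bool" where
  "valid [] \<longleftrightarrow> True"
| "valid (A # \<Gamma>) \<longleftrightarrow> is_type \<Gamma> A \<and> valid \<Gamma>"

lemma typing_valid: "\<Gamma> \<turnstile> M : A \<Longrightarrow> valid \<Gamma>"
  by (induction rule: typing.induct) (auto simp: is_type_def)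

lemma typing_closed:
  assumes "[] \<turnstile> M : A" "lift 0 M = M" "lift 0 A = A" and "valid \<Gamma>"
  shows "\<Gamma> \<turnstile> M : A"
  using \<open>valid \<Gamma>\<close>
proof (induction \<Gamma>)
  case (Cons B \<Gamma>)
  then have "B # \<Gamma> \<turnstile> lift 0 M : lift 0 A" by (intro typing_weaken) auto
  then show ?case by (simp add: assms(2,3))
qed (simp add: assms(1))

subsection \<open>Substitution\<close>

primrec context_morphism ::
  "'c pterm list \<Rightarrow> 'c pterm list \<Rightarrow> (nat \<Rightarrow> 'c pterm) \<Rightarrow> bool" where
  "context_morphism \<Delta> [] \<sigma> \<longleftrightarrow> valid \<Delta>"
| "context_morphism \<Delta> (A # \<Gamma>) \<sigma> \<longleftrightarrow>
    \<Delta> \<turnstile> \<sigma> 0 : psubst (\<sigma> \<circ> Suc) A \<and> context_morphism \<Delta> \<Gamma> (\<sigma> \<circ> Suc)"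

lemma context_morphism_weaken:
  "context_morphism \<Delta> \<Gamma> \<sigma> \<Longrightarrow> is_type \<Delta> A \<Longrightarrow> context_morphism (A # \<Delta>) \<Gamma> (lift 0 \<circ> \<sigma>)"
proof (induction \<Gamma> arbitrary: \<sigma>)
  case (Cons B \<Gamma>)
  then have "A # \<Delta> \<turnstile> lift 0 (\<sigma> 0) : lift 0 (psubst (\<sigma> \<circ> Suc) B)"
    and "context_morphism (A # \<Delta>) \<Gamma> (lift 0 \<circ> (\<sigma> \<circ> Suc))"
    by (auto intro: typing_weaken Cons.IH)
  then show ?case
    unfolding context_morphism.simps comp_assoc psubst_lift_comp by simp
qed simp

lemma context_morphism_lift_subst:
  assumes "context_morphism \<Delta> \<Gamma> \<sigma>" "is_type \<Delta> (psubst \<sigma> A)"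
  shows "context_morphism (psubst \<sigma> A # \<Delta>) (A # \<Gamma>) (lift_subst \<sigma>)"
  using assms by (simp add: context_morphism_weaken psubst_lift_comp typing_start)

lemma context_morphism_Var: "valid \<Gamma> \<Longrightarrow> context_morphism \<Gamma> \<Gamma> Var"
proof (induction \<Gamma>)
  case (Cons A \<Gamma>)
  then have "context_morphism (A # \<Gamma>) (A # \<Gamma>) (lift_subst Var)"
    using context_morphism_lift_subst[of \<Gamma> \<Gamma> Var A] by simp
  then show ?case by (simp only: lift_subst_Var)
qed simp

lemma context_morphism_Suc: "valid (A # \<Gamma>) \<Longrightarrow> context_morphism (A # \<Gamma>) \<Gamma> (Var \<circ> Suc)"
  using context_morphism_weaken[OF context_morphism_Var, of \<Gamma> A] by (simp add: comp_def)

lemma typing_Pi_is_type_domain: "\<Gamma> \<turnstile> Pi A B : C \<Longrightarrow> is_type \<Gamma> A"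
proof (induction \<Gamma> "Pi A B" C arbitrary: A B rule: typing.induct)
  case (weakening \<Gamma> M C D s)
  then obtain A' B' where "M = Pi A' B'" "A = lift 0 A'" by (cases M) (auto split: if_splits)
  with weakening show ?case by (auto intro: is_type_weaken is_typeI)
next
  case (product A \<Gamma> B s2 s1 s3)
  then show ?case by (auto intro: is_typeI rule_in_sorts)
qed

text \<open>
  In the abstraction case the domain is typed in the target context by the induction hypothesis
  for the product type, which makes the hypothesis for the body applicable.
\<close>

lemma typing_psubst:
  "\<Gamma> \<turnstile> M : A \<Longrightarrow> context_morphism \<Delta> \<Gamma> \<sigma> \<Longrightarrow> \<Delta> \<turnstile> psubst \<sigma> M : psubst \<sigma> A"
proof (induction arbitrary: \<Delta> \<sigma> rule: typing.induct)
  case (ax c s)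
  then show ?case by (auto intro: typing_closed typing.ax)
next
  case (start \<Gamma> A s)
  then show ?case by (simp add: psubst_lift)
next
  case (weakening \<Gamma> M B A s)
  then show ?case by (auto simp: psubst_lift)
next
  case (application \<Gamma> M A B N)
  then show ?case by (auto simp: psubst_subst intro!: typing.application)
next
  case (abstraction A \<Gamma> M B s)
  then have Pi: "\<Delta> \<turnstile> psubst \<sigma> (Pi A B) : Const s" by simp
  then have "is_type \<Delta> (psubst \<sigma> A)" by (auto intro: typing_Pi_is_type_domain)
  with abstraction.prems have "context_morphism (psubst \<sigma> A # \<Delta>) (A # \<Gamma>) (lift_subst \<sigma>)"
    by (rule context_morphism_lift_subst)
  then have "psubst \<sigma> A # \<Delta> \<turnstile> psubst (lift_subst \<sigma>) M : psubst (lift_subst \<sigma>) B"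
    by (rule abstraction.IH(1))
  with Pi \<open>s \<in> sorts P\<close> show ?case by (auto intro: typing.abstraction)
next
  case (product A \<Gamma> B s2 s1 s3)
  then have A: "\<Delta> \<turnstile> psubst \<sigma> A : Const s1" by simp
  then have "is_type \<Delta> (psubst \<sigma> A)" using product.hyps by (auto intro: is_typeI rule_in_sorts)
  with product.prems have "context_morphism (psubst \<sigma> A # \<Delta>) (A # \<Gamma>) (lift_subst \<sigma>)"
    by (rule context_morphism_lift_subst)
  then have "psubst \<sigma> A # \<Delta> \<turnstile> psubst (lift_subst \<sigma>) B : Const s2"
    using product.IH(1) by fastforce
  with A product.hyps show ?case by (auto intro: typing.product)
next
  case (conversion \<Gamma> M A B s)
  then have "\<Delta> \<turnstile> psubst \<sigma> B : Const s" by simp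
  then have "is_type \<Delta> (psubst \<sigma> B)" using \<open>s \<in> sorts P\<close> by (rule is_typeI)
  with conversion show ?case by (auto intro: typing_convert beta_eq_psubst)
qed

lemma typing_subst:
  assumes "A # \<Gamma> \<turnstile> M : B" "\<Gamma> \<turnstile> N : A"
  shows "\<Gamma> \<turnstile> subst M N 0 : subst B N 0"
proof -
  have "case_nat N Var \<circ> Suc = Var" by (simp add: fun_eq_iff)
  then have "context_morphism \<Gamma> (A # \<Gamma>) (case_nat N Var)"
    using assms by (simp add: context_morphism_Var typing_valid)
  with assms(1) show ?thesis by (simp only: subst_0_eq_psubst typing_psubst)
qed

lemma typing_context_conversion:
  assumes "A # \<Gamma> \<turnstile> M : B" "is_type \<Gamma> A'" "A =\<^sub>\<beta> A'"
  shows "A' # \<Gamma> \<turnstile> M : B"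
proof -
  have valid: "valid (A # \<Gamma>)" using assms(1) by (rule typing_valid)
  have "A' # \<Gamma> \<turnstile> Var 0 : lift 0 A"
  proof (rule typing_convert)
    show "A' # \<Gamma> \<turnstile> Var 0 : lift 0 A'" using assms(2) by (rule typing_start)
    show "is_type (A' # \<Gamma>) (lift 0 A)" using valid assms(2) by (simp add: is_type_weaken)
    show "lift 0 A' =\<^sub>\<beta> lift 0 A" using equivclp_sym[OF assms(3)] by (rule beta_eq_lift)
  qed
  moreover have "context_morphism (A' # \<Gamma>) \<Gamma> (Var \<circ> Suc)"
    using valid assms(2) by (simp add: context_morphism_Suc)
  ultimately have "context_morphism (A' # \<Gamma>) (A # \<Gamma>) Var"
    by (simp add: lift_0_eq_psubst)
  with assms(1) show ?thesis using typing_psubst by fastforce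
qed

subsection \<open>Generation\<close>

inductive declared :: "'c pterm list \<Rightarrow> nat \<Rightarrow> 'c pterm \<Rightarrow> bool" where
  declared_0: "declared (A # \<Gamma>) 0 (lift 0 A)"
| declared_Suc: "declared \<Gamma> i A \<Longrightarrow> declared (B # \<Gamma>) (Suc i) (lift 0 A)"

inductive syntax_directed :: "'c pterm list \<Rightarrow> 'c pterm \<Rightarrow> 'c pterm \<Rightarrow> bool" where
  sd_Var: "declared \<Gamma> i A \<Longrightarrow> syntax_directed \<Gamma> (Var i) A"
| sd_Const: "(c, s) \<in> axioms P \<Longrightarrow> syntax_directed \<Gamma> (Const c) (Const s)"
| sd_Pi: "(s1, s2, s3) \<in> rules P \<Longrightarrow> \<Gamma> \<turnstile> A : Const s1 \<Longrightarrow> A # \<Gamma> \<turnstile> B : Const s2 \<Longrightarrow>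
    syntax_directed \<Gamma> (Pi A B) (Const s3)"
| sd_Lam: "A # \<Gamma> \<turnstile> M : B \<Longrightarrow> is_type \<Gamma> (Pi A B) \<Longrightarrow> syntax_directed \<Gamma> (Lam A M) (Pi A B)"
| sd_App: "\<Gamma> \<turnstile> M : Pi A B \<Longrightarrow> \<Gamma> \<turnstile> N : A \<Longrightarrow> syntax_directed \<Gamma> (App M N) (subst B N 0)"

inductive_cases declared_0E: "declared (A # \<Gamma>) 0 B"
inductive_cases sd_VarE: "syntax_directed \<Gamma> (Var i) C"
inductive_cases sd_ConstE: "syntax_directed \<Gamma> (Const c) C"
inductive_cases sd_PiE: "syntax_directed \<Gamma> (Pi A B) C"
inductive_cases sd_LamE: "syntax_directed \<Gamma> (Lam A M) C"
inductive_cases sd_AppE: "syntax_directed \<Gamma> (App M N) C"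

lemma typing_weaken_binder:
  assumes "A # \<Gamma> \<turnstile> M : B" "is_type \<Gamma> D"
  shows "lift 0 A # D # \<Gamma> \<turnstile> lift 1 M : lift 1 B"
proof -
  have "valid (A # \<Gamma>)" using assms(1) by (rule typing_valid)
  then have "context_morphism (lift 0 A # D # \<Gamma>) (A # \<Gamma>) (lift_subst (Var \<circ> Suc))"
    using assms(2) is_type_weaken
    by (simp only: lift_0_eq_psubst context_morphism_lift_subst context_morphism_Suc valid.simps)
  with assms(1) have
    "lift 0 A # D # \<Gamma> \<turnstile> psubst (lift_subst (Var \<circ> Suc)) M : psubst (lift_subst (Var \<circ> Suc)) B"
    by (rule typing_psubst)
  then show ?thesis by (simp only: lift_1_eq_psubst)
qed

lemma syntax_directed_weaken:
  assumes "syntax_directed \<Gamma> M A" "is_type \<Gamma> D"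
  shows "syntax_directed (D # \<Gamma>) (lift 0 M) (lift 0 A)"
  using assms(1)
proof cases
  case (sd_Var i)
  then show ?thesis by (simp add: declared_Suc syntax_directed.sd_Var)
next
  case (sd_Const c s)
  then show ?thesis by (simp add: syntax_directed.sd_Const)
next
  case (sd_Pi s1 s2 s3 A B)
  then show ?thesis
    using typing_weaken[OF _ assms(2), of A "Const s1"]
      typing_weaken_binder[OF _ assms(2), of A B "Const s2"]
    by (auto intro: syntax_directed.sd_Pi)
next
  case (sd_Lam A M B)
  then show ?thesis
    using is_type_weaken[OF _ assms(2), of "Pi A B"] typing_weaken_binder[OF _ assms(2)]
    by (auto intro: syntax_directed.sd_Lam)
next
  case (sd_App M A B N)
  then show ?thesis
    using typing_weaken[OF _ assms(2), of M "Pi A B"] typing_weaken[OF _ assms(2), of N A]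
    by (auto simp: lift_0_subst intro: syntax_directed.sd_App)
qed

text \<open>
  The second conjunct keeps the conversion rule applicable: top sorts are not typable themselves.
\<close>

definition converts :: "'c pterm list \<Rightarrow> 'c pterm \<Rightarrow> 'c pterm \<Rightarrow> bool" where
  "converts \<Gamma> A B \<longleftrightarrow> A =\<^sub>\<beta> B \<and> (A = B \<or> is_type \<Gamma> B)"

lemma typing_converts: "\<Gamma> \<turnstile> M : A \<Longrightarrow> converts \<Gamma> A B \<Longrightarrow> \<Gamma> \<turnstile> M : B"
  by (auto simp: converts_def intro: typing_convert)

lemma generation: "\<Gamma> \<turnstile> M : C \<Longrightarrow> \<exists>A. syntax_directed \<Gamma> M A \<and> converts \<Gamma> A C"
proof (induction rule: typing.induct)
  case (weakening \<Gamma> M B D s)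
  then obtain A where A: "syntax_directed \<Gamma> M A" "converts \<Gamma> A B" by blast
  have D: "is_type \<Gamma> D" using weakening.hyps by (auto intro: is_typeI)
  then have "converts (D # \<Gamma>) (lift 0 A) (lift 0 B)"
    using A(2) by (auto simp: converts_def is_type_weaken beta_eq_lift)
  with syntax_directed_weaken[OF A(1) D] show ?case by blast
next
  case (conversion \<Gamma> M A B s)
  then show ?case by (auto simp: converts_def intro: equivclp_trans is_typeI)
qed (force simp: converts_def intro: syntax_directed.intros declared_0 is_typeI)+

lemma typing_VarD: "\<Gamma> \<turnstile> Var i : C \<Longrightarrow> \<exists>A. declared \<Gamma> i A \<and> A =\<^sub>\<beta> C"
  by (auto simp: converts_def dest!: generation elim!: sd_VarE)

lemma typing_ConstD: "\<Gamma> \<turnstile> Const c : C \<Longrightarrow> \<exists>s. (c, s) \<in> axioms P \<and> Const s =\<^sub>\<beta> C"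
  by (auto simp: converts_def dest!: generation elim!: sd_ConstE)

lemma typing_PiE:
  assumes "\<Gamma> \<turnstile> Pi A B : C"
  obtains s1 s2 s3 where "(s1, s2, s3) \<in> rules P" "\<Gamma> \<turnstile> A : Const s1" "A # \<Gamma> \<turnstile> B : Const s2"
    "converts \<Gamma> (Const s3) C"
  using generation[OF assms] by (auto elim!: sd_PiE)

lemma typing_LamE:
  assumes "\<Gamma> \<turnstile> Lam A M : C"
  obtains B where "A # \<Gamma> \<turnstile> M : B" "is_type \<Gamma> (Pi A B)" "converts \<Gamma> (Pi A B) C"
  using generation[OF assms] by (auto elim!: sd_LamE)

lemma typing_AppE:
  assumes "\<Gamma> \<turnstile> App M N : C"
  obtains A B where "\<Gamma> \<turnstile> M : Pi A B" "\<Gamma> \<turnstile> N : A" "converts \<Gamma> (subst B N 0) C"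
  using generation[OF assms] by (auto elim!: sd_AppE)

subsection \<open>Subject reduction\<close>

lemma is_type_subst:
  assumes "is_type \<Gamma> (Pi A B)" "\<Gamma> \<turnstile> N : A"
  shows "is_type \<Gamma> (subst B N 0)"
proof -
  obtain s1 s2 s3 where "(s1, s2, s3) \<in> rules P" and B: "A # \<Gamma> \<turnstile> B : Const s2"
    using assms(1) by (auto simp: is_type_def elim: typing_PiE)
  moreover have "\<Gamma> \<turnstile> subst B N 0 : Const s2" using typing_subst[OF B assms(2)] by simp
  ultimately show ?thesis by (auto intro: is_typeI rule_in_sorts)
qed

lemma type_correctness: "\<Gamma> \<turnstile> M : A \<Longrightarrow> (\<exists>s \<in> sorts P. A = Const s) \<or> is_type \<Gamma> A"
proof (induction rule: typing.induct)
  case (ax c s)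
  then show ?case by (simp add: axiom_in_sorts)
next
  case (start \<Gamma> A s)
  then have "is_type \<Gamma> A" by (auto intro: is_typeI)
  then show ?case by (blast intro: is_type_weaken)
next
  case (weakening \<Gamma> M B A s)
  then have "is_type \<Gamma> A" by (auto intro: is_typeI)
  with weakening show ?case by (auto intro: is_type_weaken)
next
  case (application \<Gamma> M A B N)
  then show ?case by (auto intro: is_type_subst)
next
  case (product A \<Gamma> B s2 s1 s3)
  then show ?case by (auto dest: rule_in_sorts)
qed (auto intro: is_typeI)

lemma typing_Pi_type_is_type: "\<Gamma> \<turnstile> M : Pi A B \<Longrightarrow> is_type \<Gamma> (Pi A B)"
  using type_correctness by blast

lemma typing_beta_redex:
  assumes "\<Gamma> \<turnstile> App (Lam A M) N : C"
  shows "\<Gamma> \<turnstile> subst M N 0 : C"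
proof -
  obtain A' B' where Lam: "\<Gamma> \<turnstile> Lam A M : Pi A' B'" and N: "\<Gamma> \<turnstile> N : A'"
    and C: "converts \<Gamma> (subst B' N 0) C"
    using assms by (rule typing_AppE)
  obtain B where M: "A # \<Gamma> \<turnstile> M : B" and Pi: "is_type \<Gamma> (Pi A B)"
    and "converts \<Gamma> (Pi A B) (Pi A' B')"
    using Lam by (rule typing_LamE)
  then have eq: "A =\<^sub>\<beta> A'" "B =\<^sub>\<beta> B'"
    by (auto simp: converts_def dest: Pi_beta_eq_PiD)
  have "valid (A # \<Gamma>)" using M by (rule typing_valid)
  then have "\<Gamma> \<turnstile> N : A" using typing_convert[OF N _ equivclp_sym[OF eq(1)]] by simp
  with M have "\<Gamma> \<turnstile> subst M N 0 : subst B N 0" by (rule typing_subst)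
  moreover have "is_type \<Gamma> (subst B' N 0)"
    using typing_Pi_type_is_type[OF Lam] N by (rule is_type_subst)
  ultimately have "\<Gamma> \<turnstile> subst M N 0 : subst B' N 0"
    using beta_eq_subst_left[OF eq(2)] by (rule typing_convert)
  then show ?thesis using C by (rule typing_converts)
qed

lemma typing_Pi_cong:
  assumes "\<Gamma> \<turnstile> Pi A B : C" and "A =\<^sub>\<beta> A'"
    and "\<And>s. \<Gamma> \<turnstile> A : Const s \<Longrightarrow> \<Gamma> \<turnstile> A' : Const s"
    and "\<And>s. A # \<Gamma> \<turnstile> B : Const s \<Longrightarrow> A # \<Gamma> \<turnstile> B' : Const s"
  shows "\<Gamma> \<turnstile> Pi A' B' : C"
proof -
  obtain s1 s2 s3 where rule: "(s1, s2, s3) \<in> rules P" and "\<Gamma> \<turnstile> A : Const s1"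
    and "A # \<Gamma> \<turnstile> B : Const s2" and C: "converts \<Gamma> (Const s3) C"
    using assms(1) by (rule typing_PiE)
  then have A': "\<Gamma> \<turnstile> A' : Const s1" and B': "A # \<Gamma> \<turnstile> B' : Const s2"
    using assms(3,4) by blast+
  have "is_type \<Gamma> A'" using A' rule by (auto intro: is_typeI rule_in_sorts)
  with B' have "A' # \<Gamma> \<turnstile> B' : Const s2"
    using assms(2) by (rule typing_context_conversion)
  then have "\<Gamma> \<turnstile> Pi A' B' : Const s3" using A' rule by (rule product)
  then show ?thesis using C by (rule typing_converts)
qed

lemma typing_Lam_cong:
  assumes "\<Gamma> \<turnstile> Lam A M : C" and "A =\<^sub>\<beta> A'"
    and "\<And>s. \<Gamma> \<turnstile> A : Const s \<Longrightarrow> \<Gamma> \<turnstile> A' : Const s"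
    and "\<And>B. A # \<Gamma> \<turnstile> M : B \<Longrightarrow> A # \<Gamma> \<turnstile> M' : B"
  shows "\<Gamma> \<turnstile> Lam A' M' : C"
proof -
  obtain B where "A # \<Gamma> \<turnstile> M : B" and Pi: "is_type \<Gamma> (Pi A B)" and C: "converts \<Gamma> (Pi A B) C"
    using assms(1) by (rule typing_LamE)
  then have M': "A # \<Gamma> \<turnstile> M' : B" using assms(4) by blast
  obtain s where s: "s \<in> sorts P" and "\<Gamma> \<turnstile> Pi A B : Const s"
    using Pi by (auto simp: is_type_def)
  from this(2) assms(2,3) have Pi': "\<Gamma> \<turnstile> Pi A' B : Const s" by (rule typing_Pi_cong)
  then have "is_type \<Gamma> A'" by (rule typing_Pi_is_type_domain)
  with M' have "A' # \<Gamma> \<turnstile> M' : B" using assms(2) by (rule typing_context_conversion)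
  then have "\<Gamma> \<turnstile> Lam A' M' : Pi A' B" using Pi' s by (rule abstraction)
  then have "\<Gamma> \<turnstile> Lam A' M' : Pi A B"
    using Pi beta_eq_Pi1[OF equivclp_sym[OF assms(2)]] by (rule typing_convert)
  then show ?thesis using C by (rule typing_converts)
qed

lemma typing_App_cong:
  assumes "\<Gamma> \<turnstile> App M N : C" and "N =\<^sub>\<beta> N'"
    and "\<And>A. \<Gamma> \<turnstile> M : A \<Longrightarrow> \<Gamma> \<turnstile> M' : A" and "\<And>A. \<Gamma> \<turnstile> N : A \<Longrightarrow> \<Gamma> \<turnstile> N' : A"
  shows "\<Gamma> \<turnstile> App M' N' : C"
proof -
  obtain A B where M: "\<Gamma> \<turnstile> M : Pi A B" and N: "\<Gamma> \<turnstile> N : A"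
    and C: "converts \<Gamma> (subst B N 0) C"
    using assms(1) by (rule typing_AppE)
  have "\<Gamma> \<turnstile> App M' N' : subst B N' 0" using assms(3)[OF M] assms(4)[OF N] by (rule application)
  moreover have "is_type \<Gamma> (subst B N 0)"
    using typing_Pi_type_is_type[OF M] N by (rule is_type_subst)
  moreover have "subst B N' 0 =\<^sub>\<beta> subst B N 0"
    using equivclp_sym[OF assms(2)] by (rule beta_eq_subst_right)
  ultimately have "\<Gamma> \<turnstile> App M' N' : subst B N 0" by (rule typing_convert)
  then show ?thesis using C by (rule typing_converts)
qed

theorem subject_reduction: "M \<rightarrow>\<^sub>\<beta> M' \<Longrightarrow> \<Gamma> \<turnstile> M : C \<Longrightarrow> \<Gamma> \<turnstile> M' : C"
proof (induction arbitrary: \<Gamma> C rule: beta.induct)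
  case (beta_redex A M N)
  then show ?case by (rule typing_beta_redex)
next
  case (beta_Pi1 A A' B)
  from beta_Pi1.prems show ?case by (rule typing_Pi_cong) (auto intro: beta_Pi1)
next
  case (beta_Pi2 B B' A)
  from beta_Pi2.prems show ?case by (rule typing_Pi_cong) (auto intro: beta_Pi2)
next
  case (beta_Lam1 A A' M)
  from beta_Lam1.prems show ?case by (rule typing_Lam_cong) (auto intro: beta_Lam1)
next
  case (beta_Lam2 M M' A)
  from beta_Lam2.prems show ?case by (rule typing_Lam_cong) (auto intro: beta_Lam2)
next
  case (beta_App1 M M' N)
  from beta_App1.prems show ?case by (rule typing_App_cong) (auto intro: beta_App1)
next
  case (beta_App2 N N' M)
  from beta_App2.prems show ?case by (rule typing_App_cong) (auto intro: beta_App2)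
qed

lemma subject_reduction_betas: "M \<rightarrow>\<^sub>\<beta>\<^sup>* M' \<Longrightarrow> \<Gamma> \<turnstile> M : C \<Longrightarrow> \<Gamma> \<turnstile> M' : C"
  by (induction rule: rtranclp_induct) (auto intro: subject_reduction)

lemma typing_Lam_not_Const:
  assumes "\<Gamma> \<turnstile> Lam A M : C" shows "\<not> C =\<^sub>\<beta> Const s"
proof
  obtain B where "Pi A B =\<^sub>\<beta> C" using typing_LamE[OF assms] unfolding converts_def by blast
  also assume "C =\<^sub>\<beta> Const s"
  finally show False by simp
qed

lemma typing_App_ConstD:
  assumes "\<Gamma> \<turnstile> App F N : C" "C =\<^sub>\<beta> Const s"
  shows "\<exists>s1 s2 s3. (s, s2) \<in> axioms P \<and> (s1, s2, s3) \<in> rules P"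
proof -
  obtain A B where F: "\<Gamma> \<turnstile> F : Pi A B" and N: "\<Gamma> \<turnstile> N : A" and C: "converts \<Gamma> (subst B N 0) C"
    using assms(1) by (rule typing_AppE)
  obtain s1 s2 s3 where rule: "(s1, s2, s3) \<in> rules P" and B: "A # \<Gamma> \<turnstile> B : Const s2"
    using typing_Pi_type_is_type[OF F] by (auto simp: is_type_def elim: typing_PiE)
  have "\<Gamma> \<turnstile> subst B N 0 : Const s2" using typing_subst[OF B N] by simp
  moreover have "subst B N 0 \<rightarrow>\<^sub>\<beta>\<^sup>* Const s"
    using C assms(2) unfolding converts_def by (intro beta_eq_ConstD) (rule equivclp_trans, blast+)
  ultimately have "\<Gamma> \<turnstile> Const s : Const s2" by (rule subject_reduction_betas[rotated])
  then have "(s, s2) \<in> axioms P" by (auto dest: typing_ConstD)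
  with rule show ?thesis by blast
qed

end

section \<open>Hilbert-style systems and towers of products\<close>

inductive axiom_instance :: "'c hpts \<Rightarrow> 'c pterm \<Rightarrow> 'c pterm \<Rightarrow> bool" for H where
  instance_axiom: "(c, s) \<in> haxioms H \<Longrightarrow> axiom_instance H (Const c) (Const s)"
| instance_scheme: "(M, A) \<in> schemes H \<Longrightarrow> range \<sigma> \<subseteq> hsorts H \<Longrightarrow>
    axiom_instance H (inst \<sigma> M) (inst \<sigma> A)"

lemma axiom_instance_htyping: "axiom_instance H M A \<Longrightarrow> htyping H M A"
  by (induction rule: axiom_instance.induct) (auto intro: h_ax h_scheme)

lemma size_map_pterm: "size (map_pterm f M) = size M"
  by (induction M) simp_all

lemma axiom_instance_size_bounded:
  assumes "wf_hpts H"
  obtains b where "\<And>M A. axiom_instance H M A \<Longrightarrow> size M \<le> b"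
proof
  fix M A
  let ?sizes = "insert 1 ((size \<circ> fst) ` schemes H)"
  assume "axiom_instance H M A"
  then have "size M \<in> ?sizes"
    by induction (force simp: size_map_pterm)+
  moreover have "finite ?sizes" using assms by (simp add: wf_hpts_def)
  ultimately show "size M \<le> Max ?sizes" by simp
qed

primrec tower :: "'c pterm \<Rightarrow> 'c pterm \<Rightarrow> nat \<Rightarrow> 'c pterm" where
  "tower K E 0 = E"
| "tower K E (Suc n) = Pi K (tower K E n)"

text \<open>
  \<open>T\<close> is a set because in the AUTOMATH systems the height 0 tower has
  type \<open>\<box>\<close> and the higher ones have type \<open>\<triangle>\<close>.
\<close>

locale tower_sorts = pure_type_system P for P :: "'c pts" +
  fixes T :: "'c set" and k :: 'c
  assumes no_product_over: "t \<in> T \<Longrightarrow> (t, t') \<in> axioms P \<Longrightarrow> (s1, t', s3) \<notin> rules P"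
    and rule_closed: "(s1, s2, s3) \<in> rules P \<Longrightarrow> s2 \<in> T \<Longrightarrow> s3 \<in> T"
    and rule_domain: "t \<in> T \<Longrightarrow> \<exists>t' \<in> T. (k, t, t') \<in> rules P"
    and domain_sort: "k \<in> sorts P"
begin

definition is_tower_sort :: "'c pterm \<Rightarrow> bool" where
  "is_tower_sort C \<longleftrightarrow> (\<exists>t \<in> T. C =\<^sub>\<beta> Const t)"

lemma is_tower_sortI: "t \<in> T \<Longrightarrow> Const t =\<^sub>\<beta> C \<Longrightarrow> is_tower_sort C"
  by (auto simp: is_tower_sort_def intro: equivclp_sym)

lemma is_tower_sort_Const [simp]: "is_tower_sort (Const t) \<longleftrightarrow> t \<in> T"
  by (auto simp: is_tower_sort_def)

lemma is_tower_sort_cong: "A =\<^sub>\<beta> B \<Longrightarrow> is_tower_sort A \<longleftrightarrow> is_tower_sort B"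
  unfolding is_tower_sort_def by (meson equivclp_trans equivclp_sym)

lemma typing_App_not_tower_sort: "\<Gamma> \<turnstile> App F N : C \<Longrightarrow> \<not> is_tower_sort C"
  unfolding is_tower_sort_def using typing_App_ConstD no_product_over by blast

lemma htyping_tower_sort_reduct_of_axiom:
  assumes "equivalent H P"
  shows "htyping H M C \<Longrightarrow> is_tower_sort C \<Longrightarrow> \<exists>M0 A0. axiom_instance H M0 A0 \<and> M0 \<rightarrow>\<^sub>\<beta>\<^sup>* M"
proof (induction rule: htyping.induct)
  case (h_ax c s)
  then show ?case using instance_axiom[OF h_ax.hyps] by blast
next
  case (h_scheme M A \<sigma>)
  then show ?case using instance_scheme[OF h_scheme.hyps] by blast
next
  case (h_application F A B N)
  have "[] \<turnstile> App F N : subst B N 0"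
    using assms htyping.h_application[OF h_application.hyps] by (simp add: equivalent_def)
  with h_application.prems show ?case using typing_App_not_tower_sort by blast
next
  case (h_conversion M A B s)
  then show ?case using is_tower_sort_cong by blast
next
  case (h_type_reduction M A B)
  then show ?case using is_tower_sort_cong[OF r_into_equivclp] by blast
next
  case (h_subject_reduction M A N)
  then show ?case by (blast intro: rtranclp.rtrancl_into_rtrancl)
qed

end

locale product_tower = tower_sorts P T k for P :: "'c pts" and T k +
  fixes K E :: "'c pterm"
  assumes lift_K: "lift 0 K = K" and typing_K: "typing P [] K (Const k)"
    and lift_E: "lift 0 E = E" and typing_E: "\<exists>t \<in> T. typing P [] E (Const t)"
    and typing_E_tower_sort: "typing P \<Gamma> E C \<Longrightarrow> is_tower_sort C"
begin

lemma typing_tower: "valid \<Gamma> \<Longrightarrow> \<exists>t \<in> T. \<Gamma> \<turnstile> tower K E n : Const t"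
proof (induction n arbitrary: \<Gamma>)
  case 0
  then show ?case using typing_E typing_closed lift_E by fastforce
next
  case (Suc n)
  have K: "\<Gamma> \<turnstile> K : Const k" using typing_K lift_K Suc.prems by (auto intro: typing_closed)
  then have "valid (K # \<Gamma>)" using Suc.prems domain_sort by (auto intro: is_typeI)
  then obtain t where "t \<in> T" and tower: "K # \<Gamma> \<turnstile> tower K E n : Const t"
    using Suc.IH by blast
  then obtain t' where "t' \<in> T" "(k, t, t') \<in> rules P" using rule_domain by blast
  with product[OF tower K] show ?case by auto
qed

lemma typing_towerD: "\<Gamma> \<turnstile> tower K E n : C \<Longrightarrow> is_tower_sort C"
proof (induction n arbitrary: \<Gamma> C)
  case 0
  then show ?case by (simp add: typing_E_tower_sort)
next
  case (Suc n)
  then obtain s1 s2 s3 where "(s1, s2, s3) \<in> rules P" "K # \<Gamma> \<turnstile> tower K E n : Const s2"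
    and C: "converts \<Gamma> (Const s3) C"
    by (auto elim: typing_PiE)
  then have "s3 \<in> T" using Suc.IH rule_closed by fastforce
  with C show ?case by (auto simp: converts_def intro: is_tower_sortI)
qed

lemma typing_betas_tower_le_size: "\<Gamma> \<turnstile> M : C \<Longrightarrow> M \<rightarrow>\<^sub>\<beta>\<^sup>* tower K E n \<Longrightarrow> n \<le> size M"
proof (induction n arbitrary: \<Gamma> M C)
  case (Suc n)
  have C: "is_tower_sort C"
    using subject_reduction_betas[OF Suc.prems(2,1)] by (rule typing_towerD)
  obtain A B where M: "M = Pi A B"
  proof (cases M)
    case (Lam A N)
    then show thesis using typing_Lam_not_Const Suc.prems(1) C unfolding is_tower_sort_def by blast
  next
    case (App F N)
    then show thesis using typing_App_not_tower_sort Suc.prems(1) C by blast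
  qed (use Suc.prems(2) in \<open>auto dest: betas_ConstD betas_VarD\<close>)
  with Suc.prems(2) have "B \<rightarrow>\<^sub>\<beta>\<^sup>* tower K E n" by (auto elim: betas_PiE)
  moreover obtain s2 where "A # \<Gamma> \<turnstile> B : Const s2"
    using Suc.prems(1) unfolding M by (rule typing_PiE)
  ultimately have "n \<le> size B" using Suc.IH by blast
  then show ?case by (simp add: M)
qed simp

theorem no_equivalent_hpts: "\<not> has_equivalent_hpts P"
proof
  assume "has_equivalent_hpts P"
  then obtain H where "wf_hpts H" and equiv: "equivalent H P"
    by (auto simp: has_equivalent_hpts_def)
  then obtain b where bound: "\<And>M A. axiom_instance H M A \<Longrightarrow> size M \<le> b"
    using axiom_instance_size_bounded by blast
  obtain t where "t \<in> T" and "[] \<turnstile> tower K E (Suc b) : Const t"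
    using typing_tower[of "[]" "Suc b"] by auto
  then have "htyping H (tower K E (Suc b)) (Const t)" using equiv unfolding equivalent_def by blast
  then obtain M A where M: "axiom_instance H M A" "M \<rightarrow>\<^sub>\<beta>\<^sup>* tower K E (Suc b)"
    using htyping_tower_sort_reduct_of_axiom[OF equiv] \<open>t \<in> T\<close> by fastforce
  have "[] \<turnstile> M : A"
    using axiom_instance_htyping[OF M(1)] equiv unfolding equivalent_def by blast
  then have "Suc b \<le> size M" using M(2) by (rule typing_betas_tower_le_size)
  with bound[OF M(1)] show False by simp
qed

end

section \<open>The systems\<close>

definition falsum :: "'c \<Rightarrow> 'c pterm" where
  "falsum s = Pi (Const s) (Var 0)"

lemma lift_falsum: "lift k (falsum s) = falsum s"
  by (simp add: falsum_def)

context pure_type_system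
begin

lemma typing_falsum:
  assumes "(s, s1) \<in> axioms P" "(s1, s, s3) \<in> rules P"
  shows "[] \<turnstile> falsum s : Const s3"
proof -
  have s: "[] \<turnstile> Const s : Const s1" using assms(1) by (rule ax)
  then have "[Const s] \<turnstile> Var 0 : Const s"
    using start[OF s] axiom_in_sorts[OF assms(1)] by simp
  then show ?thesis unfolding falsum_def using s assms(2) by (rule product)
qed

lemma typing_falsumD:
  assumes "\<Gamma> \<turnstile> falsum s : C"
  shows "\<exists>s1 s3. (s1, s, s3) \<in> rules P \<and> Const s3 =\<^sub>\<beta> C"
proof -
  obtain s1 s2 s3 where "(s1, s2, s3) \<in> rules P" and var: "Const s # \<Gamma> \<turnstile> Var 0 : Const s2"
    and "converts \<Gamma> (Const s3) C"
    using assms unfolding falsum_def by (rule typing_PiE)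
  moreover have "s2 = s" using typing_VarD[OF var] by (auto elim: declared_0E)
  ultimately show ?thesis by (auto simp: converts_def)
qed

end

context tower_sorts
begin

lemma no_equivalent_hpts_constant:
  assumes "(c, k) \<in> axioms P" "\<And>s. (c, s) \<in> axioms P \<Longrightarrow> s \<in> T"
  shows "\<not> has_equivalent_hpts P"
proof -
  interpret product_tower P T k "Const c" "Const c"
  proof
    show "[] \<turnstile> Const c : Const k" using assms(1) by (rule ax)
    then show "\<exists>t \<in> T. [] \<turnstile> Const c : Const t" using assms(2)[OF assms(1)] by blast
    show "is_tower_sort C" if "\<Gamma> \<turnstile> Const c : C" for \<Gamma> C
      using typing_ConstD[OF that] assms(2) by (auto intro: is_tower_sortI)
  qed simp_all
  show ?thesis by (rule no_equivalent_hpts)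
qed

lemma no_equivalent_hpts_falsum_body:
  assumes "(c, k) \<in> axioms P" "(k, c, c) \<in> rules P" "c \<in> T"
  shows "\<not> has_equivalent_hpts P"
proof -
  interpret product_tower P T k "Const c" "falsum c"
  proof
    show "[] \<turnstile> Const c : Const k" using assms(1) by (rule ax)
    show "\<exists>t \<in> T. [] \<turnstile> falsum c : Const t" using typing_falsum[OF assms(1,2)] assms(3) by blast
    show "is_tower_sort C" if "\<Gamma> \<turnstile> falsum c : C" for \<Gamma> C
      using typing_falsumD[OF that] rule_closed assms(3) by (auto intro: is_tower_sortI)
  qed (simp_all add: lift_falsum)
  show ?thesis by (rule no_equivalent_hpts)
qed

lemma no_equivalent_hpts_falsum_domain:
  assumes "(k, k') \<in> axioms P" "(k', k, k) \<in> rules P" "\<And>s. (k, s) \<in> axioms P \<Longrightarrow> s \<in> T"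
  shows "\<not> has_equivalent_hpts P"
proof -
  interpret product_tower P T k "falsum k" "Const k"
  proof
    show "[] \<turnstile> falsum k : Const k" using assms(1,2) by (rule typing_falsum)
    show "\<exists>t \<in> T. [] \<turnstile> Const k : Const t" using ax[OF assms(1)] assms(1,3) by blast
    show "is_tower_sort C" if "\<Gamma> \<turnstile> Const k : C" for \<Gamma> C
      using typing_ConstD[OF that] assms(3) by (auto intro: is_tower_sortI)
  qed (simp_all add: lift_falsum)
  show ?thesis by (rule no_equivalent_hpts)
qed

end

theorem theorem15:
  shows "\<not> has_equivalent_hpts lambda_tau \<and>
    \<not> has_equivalent_hpts lambda_2 \<and>
    \<not> has_equivalent_hpts lambda_omega \<and>
    \<not> has_equivalent_hpts lambda_weak_omega \<and>
    \<not> has_equivalent_hpts lambda_P2 \<and>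
    \<not> has_equivalent_hpts lambda_P_weak_omega \<and>
    \<not> has_equivalent_hpts lambda_C \<and>
    \<not> has_equivalent_hpts lambda_AUT68 \<and>
    \<not> has_equivalent_hpts lambda_AUTQE \<and>
    \<not> has_equivalent_hpts lambda_PAL \<and>
    \<not> has_equivalent_hpts lambda_U \<and>
    \<not> has_equivalent_hpts lambda_HOL"
proof (intro conjI)
  note tower_sorts_simps = tower_sorts_def tower_sorts_axioms_def pure_type_system_def wf_pts_def
  show "\<not> has_equivalent_hpts lambda_tau"
    by (rule tower_sorts.no_equivalent_hpts_constant[of _ "{StarT}" StarT ZeroT])
      (auto simp: tower_sorts_simps lambda_tau_def)
  show "\<not> has_equivalent_hpts lambda_2"
    by (rule tower_sorts.no_equivalent_hpts_falsum_body[of _ "{StarC}" BoxC StarC])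
      (auto simp: tower_sorts_simps lambda_2_def cube_def)
  show "\<not> has_equivalent_hpts lambda_P2"
    by (rule tower_sorts.no_equivalent_hpts_falsum_domain[of _ "{BoxC}" StarC BoxC])
      (auto simp: tower_sorts_simps lambda_P2_def cube_def)
  show "\<not> has_equivalent_hpts lambda_omega" "\<not> has_equivalent_hpts lambda_weak_omega"
    "\<not> has_equivalent_hpts lambda_P_weak_omega" "\<not> has_equivalent_hpts lambda_C"
    by (rule tower_sorts.no_equivalent_hpts_constant[of _ "{BoxC}" BoxC StarC];
        auto simp: tower_sorts_simps lambda_omega_def lambda_weak_omega_def
          lambda_P_weak_omega_def lambda_C_def cube_def)+
  show "\<not> has_equivalent_hpts lambda_AUT68" "\<not> has_equivalent_hpts lambda_AUTQE"
    "\<not> has_equivalent_hpts lambda_PAL"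
    by (rule tower_sorts.no_equivalent_hpts_constant[of _ "{Box, Triangle}" Box Star];
        auto simp: tower_sorts_simps lambda_AUT68_def lambda_AUTQE_def lambda_PAL_def)+
  show "\<not> has_equivalent_hpts lambda_U" "\<not> has_equivalent_hpts lambda_HOL"
    by (rule tower_sorts.no_equivalent_hpts_constant[of _ "{Box}" Box Star];
        auto simp: tower_sorts_simps lambda_U_def lambda_HOL_def)+
qed

end
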